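(* Let $n\ge 3$ and $3\le d_1\le d_2\le\cdots\le d_n$. In $\mathbb{C}^{d_1}\otimes\cdots\otimes\mathbb{C}^{d_n}$ consider the following product states, where in each state every party not explicitly listed is in the state $|0\rangle$: ($\mathcal{B}_1$) $|0-i\rangle_1|i\rangle_n$ for $1\le i\le d_1-1$; ($\mathcal{B}_{k+1}$, $k=1,\dots,n-1$) $|i\rangle_k|0-i\rangle_{k+1}$ for $1\le i\le d_k-1$; ($\mathcal{B}_{n+k}$, $k=1,\dots,n-2$) $|1\rangle_k|0-i\rangle_{k+1}|i\rangle_{k+2}$ for $d_k\le i\le d_{k+1}-1$; ($\mathcal{B}_{2n-1}$) $|m_i\rangle_1|1\rangle_{n-1}|(i-1)-i\rangle_n$ for $d_{n-1}\le i\le d_n-1$, where $m_i=2$ if $i$ is even and $m_i=1$ if $i$ is odd; ($\mathcal{B}_{2n}$) $|0-2\rangle_1|0-2\rangle_{n-1}|i\rangle_n$ for $d_1\le i\le d_n-1$; ($\mathcal{B}_{2n+1}$) the stopper state $\bigotimes_{l=1}^n|0+1+\cdots+(d_l-1)\rangle_l$. This set has $\sum_{i=2}^{n-1}d_i+2d_n-n+1$ elements, its states are pairwise orthogonal, and for every party $t\in\{1,\dots,n\}$, every orthogonality-preserving local POVM element $E_t$ on party $t$ for this set is proportional to the identity. Consequently, this set cannot be perfectly distinguished by LOCC.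
   Context: $\{|i\rangle\}$ is the computational basis; $|i_1\pm i_2\pm\cdots\pm i_r\rangle$ denotes $\frac{1}{\sqrt r}(|i_1\rangle\pm|i_2\rangle\pm\cdots\pm|i_r\rangle)$; subscripts indicate the party; ranges $a\le i\le b$ with $a>b$ are empty. For a set $\{|\psi_a\rangle\}$ of pairwise orthogonal states in $\mathbb{C}^{d_1}\otimes\cdots\otimes\mathbb{C}^{d_n}$, a positive semidefinite operator $E_t$ on $\mathbb{C}^{d_t}$ (a POVM element $M_t^\dagger M_t$ of a measurement by party $t$) is called orthogonality-preserving if $\langle\psi_a|(\mathbb{I}\otimes\cdots\otimes E_t\otimes\cdots\otimes\mathbb{I})|\psi_b\rangle=0$ for all $a\neq b$; the measurement is trivial if all its POVM elements are proportional to the identity. A set of orthogonal states for which every party can only perform trivial orthogonality-preserving measurements cannot be perfectly distinguished by LOCC. *)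

theory Defs
  imports Complex_Main "HOL-Library.FuncSet"
begin

text \<open>Parties are indexed 1..n; party t has local space C^(d t) with computational
basis 0..d t - 1. A local vector is a coefficient function nat => complex
(zero outside 0..d t - 1). A multipartite vector is a function on basis tuples
x :: nat => nat (only the coordinates 1..n matter; the basis tuples are the
elements of basis_box n d).\<close>

definition ket :: "nat \<Rightarrow> nat \<Rightarrow> complex" where
  "ket i = (\<lambda>j. if j = i then 1 else 0)"

definition kdiff :: "nat \<Rightarrow> nat \<Rightarrow> nat \<Rightarrow> complex" where
  "kdiff i j = (\<lambda>x. (ket i x - ket j x) / complex_of_real (sqrt 2))"

definition kunif :: "nat \<Rightarrow> nat \<Rightarrow> complex" where
  "kunif dt = (\<lambda>x. if x < dt then 1 / complex_of_real (sqrt (real dt)) else 0)"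

definition basis_box :: "nat \<Rightarrow> (nat \<Rightarrow> nat) \<Rightarrow> (nat \<Rightarrow> nat) set" where
  "basis_box n d = PiE {1..n} (\<lambda>t. {..<d t})"

definition prod_tensor :: "nat \<Rightarrow> (nat \<Rightarrow> nat \<Rightarrow> complex) \<Rightarrow> (nat \<Rightarrow> nat) \<Rightarrow> complex" where
  "prod_tensor n psi = (\<lambda>x. \<Prod>t\<in>{1..n}. psi t (x t))"

definition inner_prod :: "nat \<Rightarrow> (nat \<Rightarrow> nat) \<Rightarrow> ((nat \<Rightarrow> nat) \<Rightarrow> complex) \<Rightarrow> ((nat \<Rightarrow> nat) \<Rightarrow> complex) \<Rightarrow> complex" where
  "inner_prod n d a b = (\<Sum>x\<in>basis_box n d. cnj (a x) * b x)"

text \<open>(I \<otimes> ... \<otimes> E \<otimes> ... \<otimes> I) applied to b, E acting on party t of dimension dt,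
E given by its matrix entries E i j (i, j < dt)\<close>
definition local_apply :: "nat \<Rightarrow> nat \<Rightarrow> (nat \<Rightarrow> nat \<Rightarrow> complex) \<Rightarrow> ((nat \<Rightarrow> nat) \<Rightarrow> complex) \<Rightarrow> (nat \<Rightarrow> nat) \<Rightarrow> complex" where
  "local_apply t dt E b = (\<lambda>x. \<Sum>j<dt. E (x t) j * b (x(t := j)))"

definition psd :: "nat \<Rightarrow> (nat \<Rightarrow> nat \<Rightarrow> complex) \<Rightarrow> bool" where
  "psd dt E = (\<forall>v :: nat \<Rightarrow> complex.
      (\<Sum>i<dt. \<Sum>j<dt. cnj (v i) * E i j * v j) \<in> \<real> \<and>
      0 \<le> Re (\<Sum>i<dt. \<Sum>j<dt. cnj (v i) * E i j * v j))"

definition orth_preserving :: "nat \<Rightarrow> (nat \<Rightarrow> nat) \<Rightarrow> ((nat \<Rightarrow> nat) \<Rightarrow> complex) set \<Rightarrow> nat \<Rightarrow> (nat \<Rightarrow> nat \<Rightarrow> complex) \<Rightarrow> bool" where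
  "orth_preserving n d S t E =
     (\<forall>a\<in>S. \<forall>b\<in>S. a \<noteq> b \<longrightarrow> inner_prod n d a (local_apply t (d t) E b) = 0)"

definition trivial_op :: "nat \<Rightarrow> (nat \<Rightarrow> nat \<Rightarrow> complex) \<Rightarrow> bool" where
  "trivial_op dt E = (\<exists>c. \<forall>i<dt. \<forall>j<dt. E i j = (if i = j then c else 0))"

definition m_idx :: "nat \<Rightarrow> nat" where
  "m_idx i = (if even i then 2 else 1)"

definition base :: "nat \<Rightarrow> nat \<Rightarrow> complex" where
  "base = (\<lambda>_. ket 0)"

definition theorem2_set :: "nat \<Rightarrow> (nat \<Rightarrow> nat) \<Rightarrow> ((nat \<Rightarrow> nat) \<Rightarrow> complex) set" where
  "theorem2_set n d =
     {prod_tensor n (base(1 := kdiff 0 i, n := ket i)) | i. 1 \<le> i \<and> i < d 1}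
   \<union> {prod_tensor n (base(k := ket i, Suc k := kdiff 0 i)) | k i.
        1 \<le> k \<and> k \<le> n - 1 \<and> 1 \<le> i \<and> i < d k}
   \<union> {prod_tensor n (base(k := ket 1, Suc k := kdiff 0 i, Suc (Suc k) := ket i)) | k i.
        1 \<le> k \<and> k \<le> n - 2 \<and> d k \<le> i \<and> i < d (Suc k)}
   \<union> {prod_tensor n (base(1 := ket (m_idx i), n - 1 := ket 1, n := kdiff (i - 1) i)) | i.
        d (n - 1) \<le> i \<and> i < d n}
   \<union> {prod_tensor n (base(1 := kdiff 0 2, n - 1 := kdiff 0 2, n := ket i)) | i.
        d 1 \<le> i \<and> i < d n}
   \<union> {prod_tensor n (\<lambda>t. kunif (d t))}"

end

theory Submission
  imports Defs
begin

text \<open>The inner product of product states factors over the parties, so two of the states are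
  orthogonal as soon as one local factor vanishes; as the states are nonzero, distinct labels give
  distinct states, and the cardinality is that of the label set.

  For party \<open>t\<close>, a pair of states whose local factors at all other parties are nonzero forces
  \<open>\<langle>\<psi>\<^sub>t|E|\<phi>\<^sub>t\<rangle> = 0\<close>. Suitable pairs of states carrying kets at \<open>t\<close> kill the off-diagonal entries of
  \<open>E\<close>; only at party \<open>n - 1\<close> some entries \<open>E i 0\<close> come from \<open>E i 0 = E i 2\<close> and \<open>E i 2 = 0\<close>. Pairing the stopper with a state whose only difference vector \<open>|a - b\<rangle>\<close> sits at \<open>t\<close> then
  gives \<open>E a a = E b b\<close>, and these pairs connect all basis indices.\<close>

section \<open>Local inner products and their factorization over the parties\<close>

definition local_inner :: "nat \<Rightarrow> (nat \<Rightarrow> complex) \<Rightarrow> (nat \<Rightarrow> complex) \<Rightarrow> complex" where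
  "local_inner m f g = (\<Sum>x<m. cnj (f x) * g x)"

definition mat_app :: "nat \<Rightarrow> (nat \<Rightarrow> nat \<Rightarrow> complex) \<Rightarrow> (nat \<Rightarrow> complex) \<Rightarrow> nat \<Rightarrow> complex" where
  "mat_app m E g = (\<lambda>i. \<Sum>j<m. E i j * g j)"

lemma sum_ket:
  assumes "i < m"
  shows "(\<Sum>x<m. ket i x * g x) = g i" "(\<Sum>x<m. g x * ket i x) = g i"
proof -
  have "(\<Sum>x<m. ket i x * g x) = (\<Sum>x<m. if x = i then g x else 0)"
    by (intro sum.cong) (auto simp: ket_def)
  then show "(\<Sum>x<m. ket i x * g x) = g i" using assms by simp
  then show "(\<Sum>x<m. g x * ket i x) = g i" by (simp add: mult.commute)
qed

lemma sum_kdiff: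
  assumes "i < m" "j < m"
  shows "(\<Sum>x<m. kdiff i j x * g x) = (g i - g j) / complex_of_real (sqrt 2)"
    "(\<Sum>x<m. g x * kdiff i j x) = (g i - g j) / complex_of_real (sqrt 2)"
proof -
  have "(\<Sum>x<m. kdiff i j x * g x) =
      ((\<Sum>x<m. ket i x * g x) - (\<Sum>x<m. ket j x * g x)) / complex_of_real (sqrt 2)"
    by (simp add: kdiff_def left_diff_distrib diff_divide_distrib sum_subtractf sum_divide_distrib)
  then show *: "(\<Sum>x<m. kdiff i j x * g x) = (g i - g j) / complex_of_real (sqrt 2)"
    using assms by (simp add: sum_ket)
  show "(\<Sum>x<m. g x * kdiff i j x) = (g i - g j) / complex_of_real (sqrt 2)"
    unfolding mult.commute[of _ "kdiff _ _ _"] by (rule *)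
qed

lemma cnj_ket [simp]: "cnj (ket i x) = ket i x"
  by (simp add: ket_def)

lemma cnj_kdiff [simp]: "cnj (kdiff i j x) = kdiff i j x"
  by (simp add: kdiff_def)

lemma local_inner_ket: "i < m \<Longrightarrow> local_inner m (ket i) g = g i"
  by (simp add: local_inner_def sum_ket)

lemma local_inner_kdiff:
  "i < m \<Longrightarrow> j < m \<Longrightarrow> local_inner m (kdiff i j) g = (g i - g j) / complex_of_real (sqrt 2)"
  by (simp add: local_inner_def sum_kdiff)

lemma local_inner_kunif:
  "local_inner m (kunif m) g = (\<Sum>x<m. g x) / complex_of_real (sqrt (real m))"
  by (simp add: local_inner_def kunif_def sum_divide_distrib)

lemma local_inner_kunif_self: "0 < m \<Longrightarrow> local_inner m (kunif m) (kunif m) = 1"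
  unfolding local_inner_kunif
  by (simp add: kunif_def flip: of_real_mult real_sqrt_mult)

lemma local_inner_cnj: "local_inner m g f = cnj (local_inner m f g)"
  by (simp add: local_inner_def mult.commute)

lemma mat_app_ket: "j < m \<Longrightarrow> mat_app m E (ket j) = (\<lambda>i. E i j)"
  by (simp add: mat_app_def sum_ket)

lemma mat_app_kdiff:
  "j < m \<Longrightarrow> k < m \<Longrightarrow>
    mat_app m E (kdiff j k) = (\<lambda>i. (E i j - E i k) / complex_of_real (sqrt 2))"
  by (simp add: mat_app_def sum_kdiff)

lemma inner_prod_prod_tensor:
  "inner_prod n d (prod_tensor n a) (prod_tensor n b) =
    (\<Prod>t\<in>{1..n}. local_inner (d t) (a t) (b t))"
  unfolding inner_prod_def prod_tensor_def basis_box_def local_inner_def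
  by (subst prod_sum_PiE) (simp_all add: prod.distrib)

lemma local_apply_prod_tensor:
  assumes "t \<in> {1..n}"
  shows "local_apply t m E (prod_tensor n b) = prod_tensor n (b(t := mat_app m E (b t)))"
proof
  fix x
  have split: "(\<Prod>s\<in>{1..n}. f s) = f t * (\<Prod>s\<in>{1..n} - {t}. f s)" for f :: "nat \<Rightarrow> complex"
    using assms by (simp add: prod.remove)
  have rest: "(\<Prod>s\<in>{1..n} - {t}. b s ((x(t := j)) s)) = (\<Prod>s\<in>{1..n} - {t}. b s (x s))"
    "(\<Prod>s\<in>{1..n} - {t}. (b(t := h)) s (x s)) = (\<Prod>s\<in>{1..n} - {t}. b s (x s))" for j h
    by (auto intro!: prod.cong)
  show "local_apply t m E (prod_tensor n b) x = prod_tensor n (b(t := mat_app m E (b t))) x"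
    unfolding local_apply_def prod_tensor_def split rest
    by (simp add: mat_app_def sum_distrib_right mult.assoc)
qed

lemma inner_prod_local_apply:
  assumes "t \<in> {1..n}"
  shows "inner_prod n d (prod_tensor n a) (local_apply t (d t) E (prod_tensor n b)) =
    local_inner (d t) (a t) (mat_app (d t) E (b t)) *
    (\<Prod>s\<in>{1..n} - {t}. local_inner (d s) (a s) (b s))"
  unfolding local_apply_prod_tensor[OF assms] inner_prod_prod_tensor
  by (subst prod.remove[OF _ assms]) (auto intro!: prod.cong)

lemma ket_apply: "ket i j = (if j = i then 1 else 0)"
  by (simp add: ket_def)

lemma kdiff_apply:
  "kdiff i j x = ((if x = i then 1 else 0) - (if x = j then 1 else 0)) / complex_of_real (sqrt 2)"
  by (simp add: kdiff_def ket_def)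

lemma base_apply: "base t = ket 0"
  by (simp add: base_def)

lemma m_idx_cases: "m_idx i = 1 \<or> m_idx i = 2" and m_idx_Suc: "m_idx (Suc i) \<noteq> m_idx i"
  by (auto simp: m_idx_def)

lemmas local_simps = local_inner_ket local_inner_kdiff ket_apply kdiff_apply base_apply

lemma local_inner_kdiff_kunif:
  "i < m \<Longrightarrow> j < m \<Longrightarrow> local_inner m (kdiff i j) (kunif m) = 0"
  by (simp add: local_inner_kdiff kunif_def)

text \<open>Only the diagonal term of row \<open>a\<close> survives, so the stopper reads off
  diagonal entries of \<open>E\<close>, all scaled by the same constant.\<close>

lemma mat_app_kunif_diag:
  fixes E :: "nat \<Rightarrow> nat \<Rightarrow> complex"
  assumes "\<And>j. j < m \<Longrightarrow> j \<noteq> a \<Longrightarrow> E a j = 0" "a < m"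
  shows "mat_app m E (kunif m) a = E a a / complex_of_real (sqrt (real m))"
proof -
  have "mat_app m E (kunif m) a =
      (\<Sum>j<m. if j = a then E a a / complex_of_real (sqrt (real m)) else 0)"
    unfolding mat_app_def using assms by (intro sum.cong) (auto simp: kunif_def)
  then show ?thesis using assms by simp
qed

text \<open>The bound \<open>i < m\<close> guarantees a nonzero inner product with the uniform
  vector.\<close>

definition basis_vec :: "nat \<Rightarrow> (nat \<Rightarrow> complex) \<Rightarrow> bool" where
  "basis_vec m v \<longleftrightarrow> (\<exists>i<m. v = ket i)"

lemma basis_vec_ket: "i < m \<Longrightarrow> basis_vec m (ket i)"
  by (auto simp: basis_vec_def)

text \<open>The constructors name, in this order, the families \<open>\<B>\<^sub>1\<close>, \<open>\<B>\<^bsub>k+1\<^esub>\<close>, \<open>\<B>\<^bsub>n+k\<^esub>\<close>,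
  \<open>\<B>\<^bsub>2n-1\<^esub>\<close>, \<open>\<B>\<^bsub>2n\<^esub>\<close> and \<open>\<B>\<^bsub>2n+1\<^esub>\<close>.\<close>

datatype label = Loop nat | Link nat nat | Ext nat nat | Tail nat | Corner nat | Stopper

section \<open>Labelled states and their number\<close>

locale chain =
  fixes n :: nat and d :: "nat \<Rightarrow> nat"
  assumes n: "3 \<le> n" and d1: "3 \<le> d 1"
    and d_Suc: "\<forall>k. 1 \<le> k \<and> k < n \<longrightarrow> d k \<le> d (Suc k)"
begin

text \<open>Since \<open>3 \<le> n\<close>, the parties \<open>1\<close>, \<open>n - 1\<close> and
  \<open>n\<close> are distinct and no update overwrites another.\<close>

fun vecs :: "label \<Rightarrow> nat \<Rightarrow> nat \<Rightarrow> complex" where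
  "vecs (Loop i) = base(1 := kdiff 0 i, n := ket i)"
| "vecs (Link k i) = base(k := ket i, Suc k := kdiff 0 i)"
| "vecs (Ext k i) = base(k := ket 1, Suc k := kdiff 0 i, Suc (Suc k) := ket i)"
| "vecs (Tail i) = base(1 := ket (m_idx i), n - 1 := ket 1, n := kdiff (i - 1) i)"
| "vecs (Corner i) = base(1 := kdiff 0 2, n - 1 := kdiff 0 2, n := ket i)"
| "vecs Stopper = (\<lambda>t. kunif (d t))"

definition labels :: "label set" where
  "labels = Loop ` {1..<d 1}
     \<union> case_prod Link ` (SIGMA k:{1..n - 1}. {1..<d k})
     \<union> case_prod Ext ` (SIGMA k:{1..n - 2}. {d k..<d (Suc k)})
     \<union> Tail ` {d (n - 1)..<d n} \<union> Corner ` {d 1..<d n} \<union> {Stopper}"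

abbreviation state :: "label \<Rightarrow> (nat \<Rightarrow> nat) \<Rightarrow> complex" where
  "state p \<equiv> prod_tensor n (vecs p)"

lemma mem_labels [simp]:
  "Loop i \<in> labels \<longleftrightarrow> 1 \<le> i \<and> i < d 1"
  "Link k i \<in> labels \<longleftrightarrow> 1 \<le> k \<and> k \<le> n - 1 \<and> 1 \<le> i \<and> i < d k"
  "Ext k i \<in> labels \<longleftrightarrow> 1 \<le> k \<and> k \<le> n - 2 \<and> d k \<le> i \<and> i < d (Suc k)"
  "Tail i \<in> labels \<longleftrightarrow> d (n - 1) \<le> i \<and> i < d n"
  "Corner i \<in> labels \<longleftrightarrow> d 1 \<le> i \<and> i < d n"
  "Stopper \<in> labels"
  by (auto simp: labels_def)

lemma theorem2_set_eq: "theorem2_set n d = state ` labels"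
proof -
  have sigma: "state ` case_prod C ` (SIGMA k:A. B k) = {state (C k i) | k i. k \<in> A \<and> i \<in> B k}"
    for C A and B :: "nat \<Rightarrow> nat set" by force
  have img: "state ` C ` A = {state (C i) | i. i \<in> A}" for C and A :: "nat set" by blast
  show ?thesis
    unfolding theorem2_set_def labels_def image_Un sigma img
    by (simp add: conj_assoc)
qed

lemma d_mono: "1 \<le> i \<Longrightarrow> i \<le> j \<Longrightarrow> j \<le> n \<Longrightarrow> d i \<le> d j"
proof (induction j)
  case (Suc j)
  then show ?case using d_Suc by (cases "i = Suc j") (auto intro: order_trans)
qed simp

lemma d_ge_3: "1 \<le> t \<Longrightarrow> t \<le> n \<Longrightarrow> 3 \<le> d t"
  using d_mono[of 1 t] d1 by simp

lemma d_pred_ge_3: "3 \<le> d (n - 1)"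
  using n by (intro d_ge_3) auto

text \<open>The \<open>Ext\<close> count telescopes to \<open>d (n - 1) - d 1\<close>. Subtraction
  on naturals truncates, so the passage to integers rests on \<open>3 \<le> d k\<close> and on
  monotonicity of \<open>d\<close>.\<close>

lemma card_labels:
  "int (card labels) = (\<Sum>i=2..n-1. int (d i)) + 2 * int (d n) - int n + 1"
proof -
  have "inj_on (case_prod Link) X" "inj_on (case_prod Ext) X" "inj_on Loop Y" "inj_on Tail Y"
    "inj_on Corner Y" for X Y by (auto simp: inj_on_def)
  then have "card labels = (d 1 - 1) + (\<Sum>k=1..n-1. d k - 1) + (\<Sum>k=1..n-2. d (Suc k) - d k)
      + (d n - d (n - 1)) + (d n - d 1) + 1"
    unfolding labels_def
    \<comment> \<open>The pieces are images under different constructors, hence disjoint.\<close>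
    by (subst card_Un_disjoint, simp, simp, force)+ (simp add: card_image)
  moreover have "int (\<Sum>k=1..n-1. d k - 1) = (\<Sum>k=1..n-1. int (d k) - 1)"
    unfolding of_nat_sum
  proof (rule sum.cong)
    fix k assume "k \<in> {1..n-1}"
    then have "3 \<le> d k" by (intro d_ge_3) auto
    then show "int (d k - 1) = int (d k) - 1" by (simp add: of_nat_diff)
  qed simp
  moreover have "int (\<Sum>k=1..n-2. d (Suc k) - d k) = (\<Sum>k=1..n-2. int (d (Suc k)) - int (d k))"
    unfolding of_nat_sum
  proof (rule sum.cong)
    fix k assume "k \<in> {1..n-2}"
    then have "d k \<le> d (Suc k)" by (intro d_mono) auto
    then show "int (d (Suc k) - d k) = int (d (Suc k)) - int (d k)" by (simp add: of_nat_diff)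
  qed simp
  moreover have "(\<Sum>k=1..n-2. int (d (Suc k)) - int (d k)) = int (d (n - 1)) - int (d 1)"
    using sum_Suc_diff[of 1 "n - 2" "\<lambda>k. int (d k)"] n
    by (simp add: Suc_diff_le numeral_2_eq_2 Suc_diff_Suc)
  moreover have "(\<Sum>k=1..n-1. int (d k) - 1) =
      int (d 1) + (\<Sum>k=2..n-1. int (d k)) - (int n - 1)"
    using n by (simp add: sum_subtractf sum.atLeast_Suc_atMost numeral_2_eq_2 of_nat_diff)
  moreover have "d (n - 1) \<le> d n" "d 1 \<le> d n" using n by (auto intro: d_mono)
  ultimately show ?thesis
    using d1 n by linarith
qed

section \<open>Pairwise orthogonality of the states\<close>

lemma small_less_d:
  assumes "1 \<le> t" "t \<le> n"
  shows "0 < d t" "1 < d t" "Suc 0 < d t" "2 < d t"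
  using d_ge_3[OF assms] by auto

lemma less_d_mono: "i < d k \<Longrightarrow> 1 \<le> k \<Longrightarrow> k \<le> t \<Longrightarrow> t \<le> n \<Longrightarrow> i < d t"
  using d_mono[of k t] by simp

definition orth :: "label \<Rightarrow> label \<Rightarrow> bool" where
  "orth p q \<longleftrightarrow> (\<exists>s\<in>{1..n}. local_inner (d s) (vecs p s) (vecs q s) = 0)"

lemma orthI: "local_inner (d s) (vecs p s) (vecs q s) = 0 \<Longrightarrow> 1 \<le> s \<Longrightarrow> s \<le> n \<Longrightarrow> orth p q"
  by (auto simp: orth_def)

lemma orth_sym: "orth p q \<longleftrightarrow> orth q p"
  unfolding orth_def by (subst local_inner_cnj) simp

text \<open>Party \<open>n\<close> separates, since its ket \<open>i\<close> with
  \<open>1 \<le> i < d 1\<close> meets another ket. The exceptions are states with a difference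
  vector at \<open>n\<close>; they have a nonzero ket at \<open>n - 1\<close>, where
  \<open>Loop i\<close> has \<open>ket 0\<close>.\<close>

lemma orth_Loop:
  assumes "Loop i \<in> labels" "q \<in> labels" "q \<noteq> Loop i" "q \<noteq> Stopper"
  shows "orth (Loop i) q"
proof (cases "\<exists>j. q = Link (n - 1) j \<or> q = Tail j")
  case True
  then show ?thesis
    using assms n small_less_d[of "n - 1"]
    by (intro orthI[of "n - 1"]) (auto simp: local_simps)
next
  case False
  then show ?thesis
    using assms n less_d_mono[of i 1 n] d_mono[of 1 "n - 2"] small_less_d[of n]
    by (intro orthI[of n]) (cases q; auto simp: local_simps)+
qed

lemma orth_Link_Link:
  assumes "Link k i \<in> labels" "Link l j \<in> labels" "Link k i \<noteq> Link l j"
  shows "orth (Link k i) (Link l j)"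
proof -
  \<comment> \<open>At the smaller position \<open>k\<close> the first state has
    \<open>ket i\<close> with \<open>1 \<le> i\<close>, while the second has \<open>ket 0\<close>
    or, if \<open>k = l\<close>, another ket.\<close>
  have "orth (Link k i) (Link l j)"
    if "Link k i \<in> labels" "Link l j \<in> labels" "Link k i \<noteq> Link l j" "k \<le> l" for k i l j
    using that by (intro orthI[of k]) (auto simp: local_simps)
  then show ?thesis using assms orth_sym by (metis nat_le_linear)
qed

lemma orth_Link_Ext:
  assumes "Link k i \<in> labels" "Ext l j \<in> labels"
  shows "orth (Link k i) (Ext l j)"
proof -
  consider "k = l" | "k < l" | "l < k" by linarith
  then show ?thesis
  proof cases
    case 1
    then show ?thesis using assms n small_less_d[of "l + 2"]
      by (intro orthI[of "l + 2"]) (auto simp: local_simps)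
  next
    case 2
    then show ?thesis using assms n
      by (intro orthI[of k]) (auto simp: local_simps)
  next
    case 3
    then show ?thesis using assms n small_less_d[of l]
      by (intro orthI[of l]) (auto simp: local_simps)
  qed
qed

lemma orth_Link_Tail:
  assumes "Link k i \<in> labels" "Tail j \<in> labels"
  shows "orth (Link k i) (Tail j)"
proof (cases "k = 1")
  case True
  then show ?thesis
    using assms n small_less_d[of n] d_pred_ge_3
    by (intro orthI[of n]) (auto simp: local_simps)
next
  case False
  then show ?thesis
    using assms n small_less_d[of 1] m_idx_cases[of j]
    by (intro orthI[of 1]) (auto simp: local_simps)
qed

lemma orth_Link_Corner:
  assumes "Link k i \<in> labels" "Corner j \<in> labels"
  shows "orth (Link k i) (Corner j)"
\<comment> \<open>At party \<open>n - 1\<close> the ket \<open>i\<close> overlaps with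
  \<open>kdiff 0 2\<close> when \<open>i = 2\<close>; then party \<open>n\<close> separates because
  \<open>3 \<le> d 1 \<le> j\<close>.\<close>
proof (cases "k = n - 1 \<and> i \<noteq> 2")
  case True
  then show ?thesis
    using assms n by (intro orthI[of "n - 1"]) (auto simp: local_simps)
next
  case False
  then show ?thesis
    using assms n d1 small_less_d[of n] by (intro orthI[of n]) (auto simp: local_simps)
qed

lemma orth_Ext_Ext:
  assumes "Ext k i \<in> labels" "Ext l j \<in> labels" "Ext k i \<noteq> Ext l j"
  shows "orth (Ext k i) (Ext l j)"
proof -
  have "orth (Ext k i) (Ext l j)"
    if "Ext k i \<in> labels" "Ext l j \<in> labels" "Ext k i \<noteq> Ext l j" "k \<le> l" for k i l j
  proof (cases "k = l")
    case True
    then show ?thesis using that n less_d_mono[of i "k + 1" "k + 2"]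
      by (intro orthI[of "k + 2"]) (auto simp: local_simps)
  next
    case False
    then show ?thesis using that n small_less_d[of k]
      by (intro orthI[of k]) (auto simp: local_simps)
  qed
  then show ?thesis using assms orth_sym by (metis nat_le_linear)
qed

lemma orth_Ext_Tail:
  assumes "Ext k i \<in> labels" "Tail j \<in> labels"
  shows "orth (Ext k i) (Tail j)"
proof -
  \<comment> \<open>For \<open>k = 1\<close> the kets at party 1 may agree. If moreover
    \<open>n = 3\<close>, party \<open>n\<close> also fails when \<open>i = j - 1\<close>, but at
    party 2 \<open>kdiff 0 i\<close> with \<open>3 \<le> i\<close> is orthogonal to
    \<open>ket 1\<close>.\<close>
  consider "2 \<le> k" | "k = 1" "n - 1 = 2" | "k = 1" "3 < n"
    using assms n by fastforce
  then show ?thesis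
  proof cases
    case 1
    then show ?thesis using assms n small_less_d[of 1] m_idx_cases[of j]
      by (intro orthI[of 1]) (auto simp: local_simps)
  next
    case 2
    then have "i < d 2" using assms by (simp add: numeral_2_eq_2)
    then show ?thesis using 2 assms n d1 small_less_d[of "n - 1"]
      by (intro orthI[of "n - 1"]) (auto simp: local_simps)
  next
    case 3
    then show ?thesis using assms n small_less_d[of n] d_pred_ge_3
      by (intro orthI[of n]) (auto simp: local_simps)
  qed
qed

lemma orth_Ext_Corner:
  assumes "Ext k i \<in> labels" "Corner j \<in> labels"
  shows "orth (Ext k i) (Corner j)"
  using assms n small_less_d[of k] by (intro orthI[of k]) (auto simp: local_simps)

text \<open>Neighbouring difference vectors at party \<open>n\<close> share an index; the parity in
  \<open>m_idx\<close> separates these pairs at party 1. All other pairs have disjoint supports at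
  \<open>n\<close>.\<close>

lemma orth_Tail_Tail:
  assumes "Tail i \<in> labels" "Tail j \<in> labels" "i \<noteq> j"
  shows "orth (Tail i) (Tail j)"
proof (cases "i = Suc j \<or> j = Suc i")
  case True
  then show ?thesis
    using n small_less_d[of 1] m_idx_cases[of i] m_idx_Suc[of i] m_idx_Suc[of j]
    by (intro orthI[of 1]) (auto simp: local_simps)
next
  case False
  then show ?thesis
    using assms n d_pred_ge_3
    by (intro orthI[of n]) (auto simp: local_simps)
qed

lemma orth_Tail_Corner:
  assumes "Tail i \<in> labels" "Corner j \<in> labels"
  shows "orth (Tail i) (Corner j)"
  using assms n small_less_d[of "n - 1"] by (intro orthI[of "n - 1"]) (auto simp: local_simps)

lemma orth_Corner_Corner:
  assumes "Corner i \<in> labels" "Corner j \<in> labels" "i \<noteq> j"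
  shows "orth (Corner i) (Corner j)"
  using assms n by (intro orthI[of n]) (auto simp: local_simps)

text \<open>Every other state has a difference vector as a factor, and its coefficients sum to
  zero.\<close>

lemma orth_Stopper:
  assumes "p \<in> labels" "p \<noteq> Stopper"
  shows "orth p Stopper"
proof -
  have kdiff: "orth p Stopper"
    if "vecs p s = kdiff i j" "i < d s" "j < d s" "1 \<le> s" "s \<le> n" for s i j
    using that by (intro orthI[of s]) (simp_all add: local_inner_kdiff_kunif)
  show ?thesis
  proof (cases p)
    case (Loop i)
    then show ?thesis using assms n by (intro kdiff[of 1 0 i]) auto
  next
    case (Link k i)
    then show ?thesis using assms n less_d_mono[of i k "Suc k"] small_less_d[of "Suc k"]
      by (intro kdiff[of "Suc k" 0 i]) auto
  next
    case (Ext k i)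
    then show ?thesis using assms n by (intro kdiff[of "Suc k" 0 i]) auto
  next
    case (Tail i)
    then show ?thesis using assms n d_pred_ge_3 by (intro kdiff[of n "i - 1" i]) auto
  next
    case (Corner i)
    then show ?thesis using assms n d1 by (intro kdiff[of 1 0 2]) auto
  qed (use assms in simp)
qed

lemma orth_labels:
  assumes "p \<in> labels" "q \<in> labels" "p \<noteq> q"
  shows "orth p q"
proof -
  \<comment> \<open>Each pair of families is treated in one order only; symmetry covers the
    other.\<close>
  have "orth p q \<or> orth q p"
    using assms
    by (cases p; cases q)
      (simp_all only: label.inject label.distinct orth_Loop orth_Link_Link orth_Link_Ext
        orth_Link_Tail orth_Link_Corner orth_Ext_Ext orth_Ext_Tail orth_Ext_Corner orth_Tail_Tail
        orth_Tail_Corner orth_Corner_Corner orth_Stopper simp_thms)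
  then show ?thesis using orth_sym by blast
qed

section \<open>Distinctness of the states\<close>

lemma inner_prod_state_eq_0:
  assumes "p \<in> labels" "q \<in> labels" "p \<noteq> q"
  shows "inner_prod n d (state p) (state q) = 0"
  using orth_labels[OF assms] unfolding inner_prod_prod_tensor orth_def by (auto intro: prod_zero)

lemma inner_prod_state_self:
  assumes "p \<in> labels"
  shows "inner_prod n d (state p) (state p) \<noteq> 0"
proof -
  have "local_inner (d s) (vecs p s) (vecs p s) \<noteq> 0" if s: "s \<in> {1..n}" for s
  proof -
    have "1 \<le> s" "s \<le> n" using s by auto
    note small = small_less_d[OF this]
    show ?thesis
    proof (cases p)
      case (Loop i)
      then have "i < d s" "1 \<le> i" using assms s less_d_mono[of i 1 s] by auto
      then show ?thesis using small n by (auto simp: Loop local_simps)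
    next
      case (Link k i)
      then have "k \<le> s \<Longrightarrow> i < d s" "1 \<le> i" using assms s less_d_mono[of i k s] by auto
      then show ?thesis using small n by (auto simp: Link local_simps)
    next
      case (Ext k i)
      then have "1 \<le> k" "k \<le> n" using assms by auto
      with Ext have "Suc k \<le> s \<Longrightarrow> i < d s" "1 \<le> i"
        using assms s less_d_mono[of i "Suc k" s] d_ge_3[of k] by auto
      then show ?thesis using small n by (auto simp: Ext local_simps)
    next
      case (Tail i)
      \<comment> \<open>Truncated subtraction would give \<open>i - 1 = i\<close> at
        \<open>i = 0\<close> and a zero difference vector; \<open>3 \<le> d (n - 1) \<le> i\<close>
        excludes this.\<close>
      then have "s = n \<Longrightarrow> i < d s" "1 < i" "i - 1 \<noteq> i" using assms n d_pred_ge_3 by auto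
      then show ?thesis using small n m_idx_cases[of i] by (auto simp: Tail local_simps)
    next
      case (Corner i)
      then show ?thesis using assms small n by (auto simp: Corner local_simps)
    next
      case Stopper
      then show ?thesis using small by (simp add: local_inner_kunif_self)
    qed
  qed
  then show ?thesis unfolding inner_prod_prod_tensor by auto
qed

lemma inj_on_state: "inj_on state labels"
  using inner_prod_state_eq_0 inner_prod_state_self unfolding inj_on_def by metis

section \<open>Local conditions from pairs overlapping away from one party\<close>

definition overlap :: "nat \<Rightarrow> label \<Rightarrow> label \<Rightarrow> bool" where
  "overlap t p q \<longleftrightarrow> (\<forall>s\<in>{1..n} - {t}. local_inner (d s) (vecs p s) (vecs q s) \<noteq> 0)"

text \<open>The bounds in the premise allow factors with the indices 0, 1 and 2 to be evaluated at
  every party.\<close>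

lemma overlapI:
  assumes "\<And>s. 1 \<le> s \<Longrightarrow> s \<le> n \<Longrightarrow> s \<noteq> t \<Longrightarrow> 0 < d s \<Longrightarrow> Suc 0 < d s \<Longrightarrow> 2 < d s \<Longrightarrow>
    local_inner (d s) (vecs p s) (vecs q s) \<noteq> 0"
  shows "overlap t p q"
  using assms small_less_d by (simp add: overlap_def)

lemma overlap_sym: "overlap t p q \<longleftrightarrow> overlap t q p"
  unfolding overlap_def by (subst local_inner_cnj) simp

lemma basis_vec_base: "1 \<le> s \<Longrightarrow> s \<le> n \<Longrightarrow> basis_vec (d s) (base s)"
  by (simp add: base_apply basis_vec_ket small_less_d)

lemma overlap_Stopper:
  assumes "\<And>s. 1 \<le> s \<Longrightarrow> s \<le> n \<Longrightarrow> s \<noteq> t \<Longrightarrow> basis_vec (d s) (vecs p s)"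
  shows "overlap t p Stopper"
proof (rule overlapI)
  fix s assume s: "1 \<le> s" "s \<le> n" "s \<noteq> t"
  then obtain i where "i < d s" "vecs p s = ket i" using assms unfolding basis_vec_def by blast
  then show "local_inner (d s) (vecs p s) (vecs Stopper s) \<noteq> 0"
    by (simp add: local_inner_ket kunif_def)
qed

context
  fixes t :: nat and E :: "nat \<Rightarrow> nat \<Rightarrow> complex"
  assumes t: "t \<in> {1..n}" and op: "orth_preserving n d (state ` labels) t E"
begin

lemma local_zero:
  assumes "p \<in> labels" "q \<in> labels" "p \<noteq> q" "overlap t p q"
  shows "local_inner (d t) (vecs p t) (mat_app (d t) E (vecs q t)) = 0"
proof -
  have "state p \<noteq> state q" using inj_on_state assms by (auto simp: inj_on_def)
  then have "inner_prod n d (state p) (local_apply t (d t) E (state q)) = 0"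
    using op assms by (simp add: orth_preserving_def)
  then show ?thesis
    unfolding inner_prod_local_apply[OF t] using assms by (auto simp: overlap_def)
qed

text \<open>Orthogonality preservation applies to the pair in both orders, hence the two
  entries.\<close>

lemma entry_zero:
  assumes "p \<in> labels" "q \<in> labels" "p \<noteq> q" "overlap t p q"
    and "vecs p t = ket i" "vecs q t = ket j" "i < d t" "j < d t"
  shows "E i j = 0 \<and> E j i = 0"
  using local_zero[OF assms(1-4)] local_zero[OF assms(2,1)] assms(3-) overlap_sym[of t p q]
  by (simp add: local_inner_ket mat_app_ket)

lemma diag_eq:
  assumes offdiag: "\<And>i j. i < d t \<Longrightarrow> j < d t \<Longrightarrow> i \<noteq> j \<Longrightarrow> E i j = 0"
    and "p \<in> labels" "p \<noteq> Stopper" "overlap t p Stopper"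
    and "vecs p t = kdiff a b" "a < d t" "b < d t"
  shows "E a a = E b b"
proof -
  have "mat_app (d t) E (kunif (d t)) a - mat_app (d t) E (kunif (d t)) b = 0"
    using local_zero[of p Stopper] assms(2-) by (simp add: local_inner_kdiff)
  moreover have "mat_app (d t) E (kunif (d t)) x = E x x / complex_of_real (sqrt (real (d t)))"
    if "x < d t" for x
    using that offdiag by (intro mat_app_kunif_diag) auto
  ultimately show ?thesis using assms by simp
qed

section \<open>Vanishing of the off-diagonal entries\<close>

lemma link_zero:
  assumes "t \<le> n - 1" "1 \<le> i" "i < d t" "1 \<le> j" "j < d t" "i \<noteq> j"
  shows "E i j = 0"
proof -
  \<comment> \<open>At party \<open>Suc t\<close> the difference vectors \<open>kdiff 0 i\<close>
    and \<open>kdiff 0 j\<close> share the index 0.\<close>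
  have "overlap t (Link t i) (Link t j)"
    using assms t d_mono[of t "Suc t"] by (intro overlapI) (auto simp: local_simps)
  then show ?thesis
    using entry_zero[of "Link t i" "Link t j" i j] assms t by simp
qed

lemma link_zero_0:
  assumes "t \<le> n - 1" "1 \<le> i" "i < d t"
  shows "E i 0 = 0 \<and> E 0 i = 0"
proof (cases "t = n - 1")
  case False
  then have i: "i < d (Suc t)" using assms t less_d_mono[of i t "Suc t"] by simp
  \<comment> \<open>The partner has \<open>ket 0\<close> at \<open>t\<close>, and its
    \<open>ket i\<close> at \<open>Suc t\<close> meets \<open>kdiff 0 i\<close>.\<close>
  then have "overlap t (Link t i) (Link (Suc t) i)"
    using assms t False less_d_mono[OF i, of "Suc (Suc t)"]
    by (intro overlapI) (auto simp: local_simps)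
  then show ?thesis
    using entry_zero[of "Link t i" "Link (Suc t) i" i 0] assms t False i
    by (simp add: base_apply)
next
  case True
  have pred: "n - 1 \<noteq> n" "n - 1 \<noteq> 1" using n by auto
  show ?thesis
  \<comment> \<open>At \<open>t = n - 1\<close> the chain ends. The partner must instead carry
    \<open>ket i\<close> at party \<open>n\<close>, to meet \<open>kdiff 0 i\<close> there:
    \<open>Loop i\<close> for small \<open>i\<close>, \<open>Corner i\<close> otherwise.\<close>
  proof (cases "i < d 1")
    case less: True
    have "i < d n" using less_d_mono[OF less] n by simp
    then have "overlap t (Link t i) (Loop i)"
      using assms t True less n by (intro overlapI) (auto simp: local_simps)
    then show ?thesis
      using entry_zero[of "Link t i" "Loop i" i 0] assms t True less n pred
      by (simp add: base_apply)
  next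
    case ge: False
    have i: "i < d n" using assms t less_d_mono[of i t n] by simp
    then have ov: "overlap t (Link t i) (Corner i)"
      using assms t True ge n by (intro overlapI) (auto simp: local_simps)
    note ov' = ov[unfolded overlap_sym[of t "Link t i"]]
    have in_labels: "Link t i \<in> labels" "Corner i \<in> labels"
      using assms t True ge i by auto
    have "2 < d t" using small_less_d t by simp
    \<comment> \<open>Here \<open>3 \<le> d 1 \<le> i\<close>, so \<open>i\<close> differs from 2
      and both indices are nonzero.\<close>
    moreover from this have "E i 2 = 0" "E 2 i = 0"
      using link_zero[of i 2] link_zero[of 2 i] assms ge d1 by auto
    moreover have "local_inner (d t) (vecs (Link t i) t) (mat_app (d t) E (vecs (Corner i) t)) = 0"
      "local_inner (d t) (vecs (Corner i) t) (mat_app (d t) E (vecs (Link t i) t)) = 0"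
      using local_zero[OF in_labels _ ov] local_zero[OF in_labels(2,1) _ ov']
      by (simp_all del: vecs.simps)
    moreover have "vecs (Link t i) t = ket i" "vecs (Corner i) t = kdiff 0 2"
      using True pred by auto
    ultimately show ?thesis
      using assms
      by (simp add: local_inner_ket local_inner_kdiff mat_app_ket mat_app_kdiff)
  qed
qed

lemma last_zero:
  assumes "t = n" "1 \<le> i" "i < d n" "1 \<le> j" "j < d n" "i \<noteq> j"
  shows "E i j = 0"
proof -
  \<comment> \<open>\<open>Loop\<close> and \<open>Corner\<close> together supply every nonzero ket
    at party \<open>n\<close>. Their factors at all other parties have a component on index 0, so
    any two of them overlap.\<close>
  define P where "P k = (if k < d 1 then Loop k else Corner k)" for k
  have P: "P k \<in> labels" "vecs (P k) n = ket k" if "1 \<le> k" "k < d n" for k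
    using that n by (auto simp: P_def)
  have "overlap t (P i) (P j)"
    using assms n by (intro overlapI) (auto simp: local_simps P_def)
  moreover have "P i \<noteq> P j" using assms by (auto simp: P_def)
  ultimately show ?thesis
    using entry_zero[of "P i" "P j" i j] P assms by simp
qed

lemma last_zero_0:
  assumes "t = n" "1 \<le> i" "i < d n"
  shows "E i 0 = 0 \<and> E 0 i = 0"
proof (cases "i < d 1")
  case True
  then have "overlap t (Loop i) (Link 1 i)"
    using assms n less_d_mono[OF True, of 2]
    by (intro overlapI) (auto simp: local_simps numeral_2_eq_2)
  then show ?thesis
    using entry_zero[of "Loop i" "Link 1 i" i 0] True assms n by (auto simp: base_apply)
next
  case False
  \<comment> \<open>Index 2 makes \<open>ket 2\<close> meet \<open>kdiff 0 2\<close> at party 1. At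
    party 2 the factor \<open>kdiff 0 2\<close> of the link meets \<open>ket 0\<close>, or
    \<open>kdiff 0 2\<close> itself when \<open>n = 3\<close>.\<close>
  then have "overlap t (Corner i) (Link 1 2)"
    using assms n d1 by (intro overlapI) (auto simp: local_simps)
  then show ?thesis
    using entry_zero[of "Corner i" "Link 1 2" i 0] False assms n d1 by (auto simp: base_apply)
qed

lemma offdiag_zero:
  assumes "i < d t" "j < d t" "i \<noteq> j"
  shows "E i j = 0"
proof -
  have "t \<le> n - 1 \<or> t = n" using t by auto
  then show ?thesis
    using assms link_zero[of i j] link_zero_0[of i] link_zero_0[of j]
      last_zero[of i j] last_zero_0[of i] last_zero_0[of j]
    by (cases "i = 0"; cases "j = 0") auto
qed

section \<open>Equality of the diagonal entries\<close>

text \<open>\<open>Loop\<close>, \<open>Link\<close> and \<open>Ext\<close> compare index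
  \<open>i\<close> with 0 directly. At party \<open>n\<close> the indices from
  \<open>d (n - 1)\<close> on are reached only through \<open>Tail\<close>, which compares
  \<open>i\<close> with \<open>i - 1\<close>; hence the induction.\<close>

lemma diag_const:
  assumes "i < d t"
  shows "E i i = E 0 0"
  using assms
proof (induction i rule: less_induct)
  case (less i)
  have kdiff: "E i i = E a a"
    if "p \<in> labels" "p \<noteq> Stopper" "vecs p t = kdiff a i" "a < d t"
      "\<And>s. 1 \<le> s \<Longrightarrow> s \<le> n \<Longrightarrow> s \<noteq> t \<Longrightarrow> basis_vec (d s) (vecs p s)" for p a
    using diag_eq[OF offdiag_zero that(1,2) overlap_Stopper that(3,4)] that(5) less.prems by simp
  consider "i = 0" | "1 \<le> i" "t = 1" | "1 \<le> i" "2 \<le> t" "i < d (t - 1)"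
    | "2 \<le> t" "t < n" "d (t - 1) \<le> i" | "t = n" "d (n - 1) \<le> i"
  proof -
    have "t = 1 \<or> (2 \<le> t \<and> t < n) \<or> (2 \<le> t \<and> t = n)" using t n by auto
    then show ?thesis using that by (cases "i = 0"; cases "i < d (t - 1)") auto
  qed
  then show ?case
  proof cases
    case 2
    have "i < d n" using 2 less.prems less_d_mono[of i 1 n] n by simp
    then show ?thesis
      using 2 less.prems n
      by (intro kdiff[of "Loop i"]) (auto simp: basis_vec_base basis_vec_ket)
  next
    case 3
    then obtain k where k: "t = Suc k" "1 \<le> k" by (cases t) auto
    with 3 have i: "i < d k" by simp
    show ?thesis
    proof (rule kdiff[of "Link k i"])
      show "Link k i \<in> labels" "vecs (Link k i) t = kdiff 0 i" "0 < d t"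
        using 3 k i t less.prems by auto
      show "basis_vec (d s) (vecs (Link k i) s)" if "1 \<le> s" "s \<le> n" "s \<noteq> t" for s
        using that k i by (cases "s = k") (simp_all add: basis_vec_base basis_vec_ket)
    qed simp
  next
    case 4
    moreover from this have "3 \<le> d (t - 1)" by (intro d_ge_3) auto
    \<comment> \<open>These bounds place the kets \<open>i\<close> at \<open>t + 1\<close> and 1 at
      \<open>t - 1\<close> of the state \<open>Ext (t - 1) i\<close> within range.\<close>
    ultimately have "i < d (Suc t)" "1 < d (t - 1)" "1 \<le> i"
      using less.prems less_d_mono[of i t "Suc t"] by auto
    then show ?thesis
      using 4 less.prems n t
      by (intro kdiff[of "Ext (t - 1) i"]) (auto simp: basis_vec_base basis_vec_ket)
  next
    case 5
    then have i: "i - 1 < i" using d_pred_ge_3 by simp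
    have "E i i = E (i - 1) (i - 1)"
      using 5 less.prems n small_less_d[of 1] small_less_d[of "n - 1"] m_idx_cases[of i]
      by (intro kdiff[of "Tail i"]) (auto simp: basis_vec_base basis_vec_ket)
    then show ?thesis using less.IH[OF i] less.prems by simp
  qed simp
qed

lemma trivial: "trivial_op (d t) E"
  unfolding trivial_op_def
proof (intro exI allI impI)
  fix i j assume "i < d t" "j < d t"
  then show "E i j = (if i = j then E 0 0 else 0)"
    using diag_const[of i] offdiag_zero[of i j] by (cases "i = j") simp_all
qed

end

end

theorem theorem2:
  fixes n :: nat and d :: "nat \<Rightarrow> nat"
  assumes "3 \<le> n"
    and "3 \<le> d 1"
    and "\<forall>k. 1 \<le> k \<and> k < n \<longrightarrow> d k \<le> d (Suc k)"
  shows "(int (card (theorem2_set n d)) =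
           (\<Sum>i=2..n-1. int (d i)) + 2 * int (d n) - int n + 1) \<and>
         (\<forall>a\<in>theorem2_set n d. \<forall>b\<in>theorem2_set n d. a \<noteq> b \<longrightarrow> inner_prod n d a b = 0) \<and>
         (\<forall>t\<in>{1..n}. \<forall>E. psd (d t) E \<and> orth_preserving n d (theorem2_set n d) t E
           \<longrightarrow> trivial_op (d t) E)"
proof -
  interpret chain n d using assms by unfold_locales
  have "card (theorem2_set n d) = card labels"
    unfolding theorem2_set_eq by (rule card_image[OF inj_on_state])
  moreover have "\<forall>a\<in>theorem2_set n d. \<forall>b\<in>theorem2_set n d. a \<noteq> b \<longrightarrow> inner_prod n d a b = 0"
    unfolding theorem2_set_eq by (auto intro!: inner_prod_state_eq_0)
  moreover have "\<forall>t\<in>{1..n}. \<forall>E. psd (d t) E \<and> orth_preserving n d (theorem2_set n d) t E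
      \<longrightarrow> trivial_op (d t) E"
    unfolding theorem2_set_eq by (auto intro: trivial)
  ultimately show ?thesis using card_labels by simp
qed

end
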